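(* Let $X_1,X_2$ be i.i.d. random variables taking their values almost surely in $[0,1]$ with finite mean $\mu^{(1)}$, let $\phi(x)=(1,x,x^2)$ be the feature vector, and let $\tilde H\in\mathbb{R}^{3\times 3}$ be a symmetric matrix. Then $$\sup_{\sigma\in\mathcal{K}(\mu^{(1)})}\mathrm{Tr}(\tilde H\sigma\sigma^\top)\ \leqslant\ \sup_{M}\ \mathrm{Tr}(\tilde HM),$$ where the supremum on the right is over symmetric positive semidefinite matrices $M\in\mathbb{R}^{3\times3}$ such that $$0\leqslant\mathrm{Tr}(ME_{1,1})\leqslant\mathrm{Tr}(ME_{0,2})\leqslant\mathrm{Tr}(ME_{0,1})\leqslant 1,\qquad\mathrm{Tr}(ME_{0,0})=1.$$
   Context: $\mathcal{K}(\mu^{(1)})$ is the set of achievable feature moments: $\mathcal{K}(\mu^{(1)})=\{\int_0^1\phi(x)\,dp(x)\in\mathbb{R}^3 : p \text{ a probability distribution on }[0,1],\ \int_0^1x\,dp(x)=\mu^{(1)}\}$. Rows and columns of $3\times3$ matrices are indexed by $0,1,2$, and $E_{i,j}$ is the elementary matrix with a $1$ in position $(i,j)$ and zeros elsewhere, so that $\mathrm{Tr}(ME_{i,j})=M_{ij}$ for symmetric $M$. *)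

theory Defs
  imports "HOL-Probability.Probability"
begin

text \<open>
  Rows and columns of \<open>3 \<times> 3\<close> matrices are indexed by the elements \<open>0, 1, 2\<close> of the numeral type \<open>3\<close>
  (arithmetic modulo three, so that the element written \<open>3\<close> by \<^const>\<open>vector\<close> is the index \<open>0\<close>;
  we therefore define vectors and matrices componentwise).
\<close>

definition phi :: "real \<Rightarrow> real^3" where
  "phi x = (\<chi> i. if i = 0 then 1 else if i = 1 then x else x\<^sup>2)"

text \<open>
  The probability distributions on \<open>[0,1]\<close> are the Borel probability measures with underlying
  space \<open>{0..1}\<close>.
\<close>

definition distributions_on_unit_interval :: "real measure set" where
  "distributions_on_unit_interval =
     {p. prob_space p \<and> sets p = sets (restrict_space borel {0..1})}"

definition achievable_moments :: "real \<Rightarrow> (real^3) set" where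
  "achievable_moments \<mu> =
     {(\<integral>x. phi x \<partial>p) | p. p \<in> distributions_on_unit_interval \<and> (\<integral>x. x \<partial>p) = \<mu>}"

text \<open>The product of a column vector with its transpose, \<open>\<real>\<^sup>3\<close> being read as the \<open>3 \<times> 1\<close> matrices.\<close>

definition self_outer :: "real^3 \<Rightarrow> real^3^3" where
  "self_outer \<sigma> = (columnvector \<sigma> :: real^1^3) ** transpose (columnvector \<sigma>)"

definition elem_mat :: "3 \<Rightarrow> 3 \<Rightarrow> real^3^3" where
  "elem_mat i j = (\<chi> k l. if k = i \<and> l = j then 1 else 0)"

definition sym_psd :: "real^'n^'n \<Rightarrow> bool" where
  "sym_psd M \<longleftrightarrow> transpose M = M \<and> (\<forall>v. 0 \<le> v \<bullet> (M *v v))"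

definition feasible_matrices :: "(real^3^3) set" where
  "feasible_matrices =
     {M. sym_psd M \<and>
         0 \<le> trace (M ** elem_mat 1 1) \<and>
         trace (M ** elem_mat 1 1) \<le> trace (M ** elem_mat 0 2) \<and>
         trace (M ** elem_mat 0 2) \<le> trace (M ** elem_mat 0 1) \<and>
         trace (M ** elem_mat 0 1) \<le> 1 \<and>
         trace (M ** elem_mat 0 0) = 1}"

end

theory Submission
  imports Defs
begin

text \<open>
  For \<open>\<sigma> = \<integral> \<phi> dp\<close> the rank-one matrix \<open>M = \<sigma>\<sigma>\<^sup>T\<close> is itself feasible: its first row is \<open>\<sigma>\<close>, so
  the constraints read \<open>0 \<le> \<sigma>\<^sub>1\<^sup>2 \<le> \<sigma>\<^sub>2 \<le> \<sigma>\<^sub>1 \<le> 1\<close>. The second inequality is nonnegativity of the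
  variance, and the others follow from \<open>x\<^sup>2 \<le> x \<le> 1\<close> on \<open>[0,1]\<close>.
\<close>

lemma self_outer_nth [simp]: "self_outer \<sigma> $ i $ j = \<sigma> $ i * \<sigma> $ j"
  by (simp add: self_outer_def columnvector_def matrix_matrix_mult_def transpose_def)

text \<open>Right multiplication by \<open>elem_mat i j\<close> moves column \<open>i\<close> of
  \<open>M\<close> into column \<open>j\<close> and clears the rest, so a single diagonal entry
  survives. The indices come out swapped, which is harmless for symmetric \<open>M\<close>.\<close>

lemma trace_mult_elem_mat [simp]: "trace (M ** elem_mat i j) = M $ j $ i"
proof -
  have "(M ** elem_mat i j) $ l $ l = (if l = j then M $ j $ i else 0)" for l
    by (cases "l = j") (simp_all add: matrix_matrix_mult_def elem_mat_def if_distrib cong: if_cong)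
  then show ?thesis
    by (simp add: trace_def)
qed

lemma sym_psd_self_outer: "sym_psd (self_outer \<sigma>)"
proof -
  have "v \<bullet> (self_outer \<sigma> *v v) = (v \<bullet> \<sigma>)\<^sup>2" for v
    by (simp add: inner_vec_def matrix_vector_mult_def power2_eq_square sum_product
          sum_distrib_left mult_ac)
  then show ?thesis
    by (simp add: sym_psd_def transpose_def vec_eq_iff mult.commute)
qed

text \<open>Continuity on a compact set gives boundedness, and bounded measurable functions are
  integrable for a probability measure. This covers \<open>phi\<close> and both moments.\<close>

lemma integrable_continuous_unit_interval:
  fixes f :: "real \<Rightarrow> 'b::{banach, second_countable_topology}"
  assumes p: "p \<in> distributions_on_unit_interval" and f: "continuous_on {0..1} f"
  shows "integrable p f"
proof -
  have sets: "sets p = sets (restrict_space borel {0..1})"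
    using p by (simp add: distributions_on_unit_interval_def)
  interpret prob_space p
    using p by (simp add: distributions_on_unit_interval_def)
  have "space p = {0..1}"
    using sets_eq_imp_space_eq[OF sets] by (simp add: space_restrict_space)
  moreover have "bounded (f ` {0..1})"
    using compact_continuous_image[OF f] by (simp add: compact_imp_bounded)
  then obtain B where "\<forall>x\<in>{0..1}. norm (f x) \<le> B"
    by (auto simp: bounded_iff)
  moreover have "f \<in> borel_measurable p"
    using borel_measurable_continuous_on_restrict[OF f] measurable_cong_sets[OF sets refl]
    by blast
  ultimately show ?thesis
    by (intro integrable_const_bound[of _ B] AE_I2) auto
qed

lemma self_outer_achievable_feasible:
  assumes "\<sigma> \<in> achievable_moments \<mu>"
  shows "self_outer \<sigma> \<in> feasible_matrices"
proof -
  obtain p where p: "p \<in> distributions_on_unit_interval" and \<sigma>: "\<sigma> = (\<integral>x. phi x \<partial>p)"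
    using assms by (auto simp: achievable_moments_def)
  interpret prob_space p
    using p by (simp add: distributions_on_unit_interval_def)
  have space: "space p = {0..1}"
    using p sets_eq_imp_space_eq[of p "restrict_space borel {0..1}"]
    by (simp add: distributions_on_unit_interval_def space_restrict_space)
  note int = integrable_continuous_unit_interval[OF p]
  have phi: "continuous_on {0..1} phi"
    unfolding phi_def
  proof (rule continuous_on_vec_lambda)
    show "continuous_on {0..1} (\<lambda>x. if i = 0 then 1 else if i = 1 then x else x\<^sup>2 :: real)"
      for i :: 3
      by (cases "i = 0"; cases "i = 1") (auto intro!: continuous_intros)
  qed
  \<comment> \<open>Taking a coordinate is bounded linear, hence commutes with the vector-valued
    integral of the integrable \<open>phi\<close>.\<close>
  have nth: "\<sigma> $ i = (\<integral>x. phi x $ i \<partial>p)" for i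
    using integral_bounded_linear[OF bounded_linear_vec_nth int[OF phi]] by (simp add: \<sigma>)
  have ix: "integrable p (\<lambda>x. x)" and ix2: "integrable p (\<lambda>x. x\<^sup>2)"
    by (auto intro!: int continuous_intros)
  have \<sigma>0: "\<sigma> $ 0 = 1" and \<sigma>1: "\<sigma> $ 1 = (\<integral>x. x \<partial>p)" and \<sigma>2: "\<sigma> $ 2 = (\<integral>x. x\<^sup>2 \<partial>p)"
    by (simp_all add: nth phi_def prob_space)
  have "\<sigma> $ 1 * \<sigma> $ 1 \<le> \<sigma> $ 2"
    using variance_eq[OF ix ix2] variance_positive[of "\<lambda>x. x"] \<sigma>1 \<sigma>2
    by (simp add: power2_eq_square)
  moreover have "\<sigma> $ 2 \<le> \<sigma> $ 1"
    unfolding \<sigma>1 \<sigma>2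
    by (intro integral_mono ix ix2) (auto simp: space power2_eq_square mult_left_le)
  moreover have "\<sigma> $ 1 \<le> 1"
    unfolding \<sigma>1 by (rule integral_le_const[OF ix]) (auto simp: space)
  ultimately show ?thesis
    by (simp add: feasible_matrices_def sym_psd_self_outer \<sigma>0)
qed

theorem proposition13:
  fixes P :: "'a measure"
    and X1 X2 :: "'a \<Rightarrow> real"
    and \<mu> :: real
    and H :: "real^3^3"
  assumes "prob_space P"
    and "prob_space.indep_var P borel X1 borel X2"
    and "distr P borel X1 = distr P borel X2"
    and "AE \<omega> in P. X1 \<omega> \<in> {0..1}"
    and "AE \<omega> in P. X2 \<omega> \<in> {0..1}"
    and "integrable P X1"
    and "(\<integral>\<omega>. X1 \<omega> \<partial>P) = \<mu>"
    and "transpose H = H"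
  shows "(SUP \<sigma>\<in>achievable_moments \<mu>. ereal (trace (H ** self_outer \<sigma>)))
           \<le> (SUP M\<in>feasible_matrices. ereal (trace (H ** M)))"
  \<comment> \<open>The witness for \<sigma> is \<open>self_outer \<sigma>\<close>, with the same
    objective value. In \<open>ereal\<close> both suprema exist, even over empty or unbounded
    sets.\<close>
  by (intro SUP_mono) (auto intro: self_outer_achievable_feasible)

end
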